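(* Let $0\le\alpha\le 1$ and let $f\in\mathcal{BS}(\alpha)$ have the Taylor expansion $f(z)=z+\sum_{n=2}^\infty a_nz^n$ in $\mathbb{D}$. Then $$|a_2|\le 1,\qquad |a_3|\le \frac{1}{2},\qquad |a_4|\le\begin{cases}\dfrac13, & 0\le\alpha\le\frac12,\\[2mm] \dfrac{1+2\alpha}{6}, & \frac12\le\alpha\le 1.\end{cases}$$ All these inequalities are sharp, i.e. for each $\alpha\in[0,1]$ and each of the three inequalities there is a function in $\mathcal{BS}(\alpha)$ for which equality holds.
   Context: $\mathbb{D}=\{z\in\mathbb{C}:|z|<1\}$. $\mathcal{A}$ is the class of analytic functions $f$ in $\mathbb{D}$ with $f(0)=0$, $f'(0)=1$. For analytic $f,g$ in $\mathbb{D}$, $f$ is subordinate to $g$, written $f\prec g$, if there is an analytic $\omega:\mathbb{D}\to\mathbb{D}$ with $\omega(0)=0$ and $f(z)=g(\omega(z))$ for all $z\in\mathbb{D}$. For $0\le\alpha\le1$ let $F_\alpha(z)=\dfrac{z}{1-\alpha z^2}$, and let $\mathcal{BS}(\alpha)$ be the class of $f\in\mathcal{A}$ such that $\dfrac{zf'(z)}{f(z)}-1\prec F_\alpha(z)$ (in particular $zf'(z)/f(z)$ is analytic in $\mathbb{D}$, with value $1$ at $z=0$). *)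

theory Defs
  imports "HOL-Complex_Analysis.Complex_Analysis"
begin

abbreviation unit_disc :: "complex set" where
  "unit_disc \<equiv> ball 0 1"

definition class_A :: "(complex \<Rightarrow> complex) set" where
  "class_A = {f. f holomorphic_on unit_disc \<and> f 0 = 0 \<and> deriv f 0 = 1}"

definition subordinate :: "(complex \<Rightarrow> complex) \<Rightarrow> (complex \<Rightarrow> complex) \<Rightarrow> bool" where
  "subordinate f g \<longleftrightarrow>
     f holomorphic_on unit_disc \<and> g holomorphic_on unit_disc \<and>
     (\<exists>\<omega>. \<omega> holomorphic_on unit_disc \<and> \<omega> ` unit_disc \<subseteq> unit_disc \<and> \<omega> 0 = 0 \<and>
          (\<forall>z\<in>unit_disc. f z = g (\<omega> z)))"

definition booth_F :: "real \<Rightarrow> complex \<Rightarrow> complex" where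
  "booth_F \<alpha> z = z / (1 - of_real \<alpha> * z\<^sup>2)"

(* z f'(z) / f(z) with its removable singularity at the origin filled in by the value 1
   (the HOL quotient 0 / 0 would be 0). *)
definition star_quotient :: "(complex \<Rightarrow> complex) \<Rightarrow> complex \<Rightarrow> complex" where
  "star_quotient f z = (if z = 0 then 1 else z * deriv f z / f z)"

(* The quotient being analytic in the disc means in particular that f has no zero
   other than the origin; this is stated explicitly because x / 0 = 0 in HOL. *)
definition class_BS :: "real \<Rightarrow> (complex \<Rightarrow> complex) set" where
  "class_BS \<alpha> =
     {f \<in> class_A. (\<forall>z\<in>unit_disc - {0}. f z \<noteq> 0) \<and>
                   subordinate (\<lambda>z. star_quotient f z - 1) (booth_F \<alpha>)}"

(* f(z) = z + (\<Sum>n\<ge>2. a n * z^n) on the disc; the values a 0 and a 1 play no role. *)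
definition taylor_coeffs :: "(complex \<Rightarrow> complex) \<Rightarrow> (nat \<Rightarrow> complex) \<Rightarrow> bool" where
  "taylor_coeffs f a \<longleftrightarrow>
     (\<forall>z\<in>unit_disc. (\<lambda>n. a (n + 2) * z ^ (n + 2)) sums (f z - z))"

end

theory Submission imports Defs begin

text \<open>
  Write the Schwarz function of f as a power series with coefficients \<open>c1\<close>, \<open>c2\<close>, \<open>c3\<close>. Comparing
  coefficients gives \<open>a2 = c1\<close>, \<open>a3 = (c2 + c1^2) / 2\<close> and
  \<open>a4 = (c3 + 3/2 c1 c2 + (\<alpha> + 1/2) c1^3) / 3\<close>. Two steps of Schur's algorithm parametrize the
  \<open>ci\<close> by three points of the closed disc, after which the estimate of
  \<open>c3 + 3/2 c1 c2 + \<nu> c1^3\<close> is elementary: it is convex in \<open>\<nu>\<close>, so \<open>0 \<le> \<nu> \<le> 1\<close> reduces to the end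
  points, and \<open>\<nu> \<ge> 1\<close> reduces to \<open>\<nu> = 1\<close>. Equality holds for the Schwarz functions \<open>z\<close>, \<open>z^2\<close> and
  \<open>z^3\<close>.
\<close>

section \<open>Coefficients of products and identities of power series\<close>

unbundle no vec_syntax

lemma fps_mult_nth_small:
  fixes A B :: "'a::comm_semiring_1 fps"
  shows "(A * B) $ 0 = A $ 0 * B $ 0"
    and "(A * B) $ 1 = A $ 0 * B $ 1 + A $ 1 * B $ 0"
    and "(A * B) $ 2 = A $ 0 * B $ 2 + A $ 1 * B $ 1 + A $ 2 * B $ 0"
    and "(A * B) $ 3 = A $ 0 * B $ 3 + A $ 1 * B $ 2 + A $ 2 * B $ 1 + A $ 3 * B $ 0"
    and "(A * B) $ 4 = A $ 0 * B $ 4 + A $ 1 * B $ 3 + A $ 2 * B $ 2 + A $ 3 * B $ 1 + A $ 4 * B $ 0"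
  by (simp_all add: fps_mult_nth eval_nat_numeral add.assoc)

lemmas has_fps_expansion_arith =
  has_fps_expansion_add has_fps_expansion_diff has_fps_expansion_mult has_fps_expansion_cmult_left
  has_fps_expansion_1 has_fps_expansion_const has_fps_expansion_fps_X has_fps_expansion_deriv

lemma has_fps_expansion_eq_on_ball:
  fixes F G :: "complex fps"
  assumes "f has_fps_expansion F" "g has_fps_expansion G" "r > 0" "\<And>z. z \<in> ball 0 r \<Longrightarrow> f z = g z"
  shows "F = G"
proof -
  have "eventually (\<lambda>z::complex. z \<in> ball 0 r) (nhds 0)"
    using assms(3) by (intro eventually_nhds_in_open) auto
  then have "eventually (\<lambda>z. f z = g z) (nhds 0)"
    by eventually_elim (use assms(4) in auto)
  then have "g has_fps_expansion F"
    using assms(1) has_fps_expansion_cong by blast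
  then show ?thesis
    using assms(2) fps_expansion_unique_complex by blast
qed

lemma has_fps_expansion_unit_disc:
  "f holomorphic_on unit_disc \<Longrightarrow> f has_fps_expansion fps_expansion f 0"
  by (rule has_fps_expansion_fps_expansion[of "unit_disc"]) auto

section \<open>Schur's algorithm for Schwarz functions\<close>

text \<open>At the origin the Schwarz lemma bounds the derivative, which is \<open>h 0\<close>. The
  bound on \<open>h\<close> cannot be strict: \<open>h\<close> is a unimodular constant when
  \<open>f\<close> is a rotation.\<close>

lemma Schwarz_quotient:
  assumes "f holomorphic_on unit_disc" "f 0 = 0" "\<And>z. z \<in> unit_disc \<Longrightarrow> cmod (f z) < 1"
  obtains h where "h holomorphic_on unit_disc" "\<And>z. z \<in> unit_disc \<Longrightarrow> f z = z * h z"
    "\<And>z. z \<in> unit_disc \<Longrightarrow> cmod (h z) \<le> 1"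
proof -
  obtain h where h: "h holomorphic_on unit_disc" "\<And>z. norm z < 1 \<Longrightarrow> f z = z * h z"
      "deriv f 0 = h 0"
    using Schwarz3[OF assms(1,2)] by blast
  have no: "norm z < 1 \<Longrightarrow> norm (f z) < 1" for z
    using assms(3) by simp
  have "cmod (h z) \<le> 1" if "z \<in> unit_disc" for z
  proof (cases "z = 0")
    case True
    then show ?thesis
      using Schwarz_Lemma(2)[OF assms(1,2) no, of 0] h(3) by simp
  next
    case False
    have "cmod (z * h z) \<le> cmod z"
      using Schwarz_Lemma(1)[OF assms(1,2) no, of z] h(2)[of z] that by simp
    then show ?thesis
      using False by (simp add: norm_mult)
  qed
  then show thesis
    using that h by auto
qed

lemma disc_automorphism_cancel:
  fixes c u w :: complex
  assumes "w = (u - c) / (1 - cnj c * u)" "1 - cnj c * u \<noteq> 0"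
  shows "u * (1 + cnj c * w) = c + w"
proof -
  have "w * (1 - cnj c * u) = u - c"
    using assms by simp
  then show ?thesis by algebra
qed

lemma cmod_mult_lt_1:
  fixes u v :: complex
  assumes "cmod u < 1" "cmod v < 1"
  shows "cmod (u * v) < 1"
  using mult_strict_mono[of "cmod u" 1 "cmod v" 1] assms by (simp add: norm_mult)

text \<open>The disc automorphism that sends \<open>g 0\<close> to 0 is applied to \<open>g\<close>,
  and the Schwarz lemma splits off a factor \<open>z\<close>. For non-constant \<open>g\<close> the
  maximum modulus principle keeps the automorphism defined. Without denominators the relation also
  covers constant \<open>g\<close>, even unimodular, with \<open>h = 0\<close>.\<close>

lemma Schur_step:
  assumes hol: "g holomorphic_on unit_disc" and bd: "\<And>z. z \<in> unit_disc \<Longrightarrow> cmod (g z) \<le> 1"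
  obtains h where "h holomorphic_on unit_disc" "\<And>z. z \<in> unit_disc \<Longrightarrow> cmod (h z) \<le> 1"
    "\<forall>z\<in>unit_disc. g z * (1 + cnj (g 0) * (z * h z)) = g 0 + z * h z"
proof (cases "g constant_on unit_disc")
  case True
  then obtain b where b: "\<And>z. z \<in> unit_disc \<Longrightarrow> g z = b"
    by (auto simp: constant_on_def)
  show thesis
    by (rule that[of "\<lambda>_. 0"]) (simp_all add: b)
next
  case False
  have lt: "cmod (g z) < 1" if z: "z \<in> unit_disc" for z
  proof (rule ccontr)
    assume "\<not> cmod (g z) < 1"
    with bd[OF z] have "cmod (g z) = 1" by simp
    then have "g constant_on unit_disc"
      using bd z by (intro maximum_modulus_principle[OF hol, of unit_disc z]) auto
    with False show False ..
  qed
  define \<phi> where "\<phi> = (\<lambda>z. (g z - g 0) / (1 - cnj (g 0) * g z))"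
  have c: "cmod (g 0) < 1" using lt by simp
  have nz: "1 - cnj (g 0) * g z \<noteq> 0" if "z \<in> unit_disc" for z
    using cmod_mult_lt_1[of "cnj (g 0)" "g z"] c lt[OF that]
    by (metis complex_mod_cnj norm_one order_less_irrefl right_minus_eq)
  have "\<phi> holomorphic_on unit_disc"
    unfolding \<phi>_def using nz by (intro holomorphic_intros hol) auto
  moreover have "\<phi> 0 = 0" by (simp add: \<phi>_def)
  moreover have "cmod (\<phi> z) < 1" if "z \<in> unit_disc" for z
    using Moebius_function_norm_lt_1[OF c lt[OF that], of 0]
    by (simp add: \<phi>_def Moebius_function_def)
  ultimately obtain h where h: "h holomorphic_on unit_disc"
      "\<And>z. z \<in> unit_disc \<Longrightarrow> \<phi> z = z * h z" "\<And>z. z \<in> unit_disc \<Longrightarrow> cmod (h z) \<le> 1"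
    by (rule Schwarz_quotient[of \<phi>]) (assumption | rule that)+
  have "g z * (1 + cnj (g 0) * (z * h z)) = g 0 + z * h z" if "z \<in> unit_disc" for z
  proof -
    have "z * h z = (g z - g 0) / (1 - cnj (g 0) * g z)"
      using h(2)[OF that] by (simp only: \<phi>_def)
    from disc_automorphism_cancel[OF this nz[OF that]] show ?thesis .
  qed
  with that h(1,3) show thesis by blast
qed

text \<open>Comparison of the coefficients of z and z^2 in the relation of
  \<open>Schur_step\<close>; the product \<open>cnj (G $ 0) * G $ 0\<close> is the squared modulus
  of \<open>G $ 0\<close>.\<close>

lemma Schur_step_coeffs:
  assumes g: "g has_fps_expansion G" and h: "h has_fps_expansion H"
    and eq: "\<forall>z\<in>unit_disc. g z * (1 + cnj (g 0) * (z * h z)) = g 0 + z * h z"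
  shows "G $ 1 = (1 - cnj (G $ 0) * G $ 0) * H $ 0"
    and "G $ 2 = (1 - cnj (G $ 0) * G $ 0) * H $ 1 - cnj (G $ 0) * H $ 0 * G $ 1"
proof -
  have 0: "g 0 = G $ 0"
    by (rule has_fps_expansion_imp_0_eq_fps_nth_0[OF g])
  have "(\<lambda>z. g z * (1 + cnj (g 0) * (z * h z))) has_fps_expansion
      G * (1 + fps_const (cnj (g 0)) * (fps_X * H))"
    by (intro has_fps_expansion_arith g h)
  moreover have "(\<lambda>z. g 0 + z * h z) has_fps_expansion fps_const (g 0) + fps_X * H"
    by (intro has_fps_expansion_arith h)
  ultimately have "G * (1 + fps_const (cnj (g 0)) * (fps_X * H)) = fps_const (g 0) + fps_X * H"
    by (rule has_fps_expansion_eq_on_ball[OF _ _ zero_less_one bspec[OF eq]])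
  then have *: "G * (1 + fps_const (cnj (G $ 0)) * (fps_X * H)) = fps_const (G $ 0) + fps_X * H"
    unfolding 0 .
  show 1: "G $ 1 = (1 - cnj (G $ 0) * G $ 0) * H $ 0"
    using arg_cong[OF *, of "\<lambda>F. F $ 1"] by (simp add: fps_mult_nth_small algebra_simps)
  show "G $ 2 = (1 - cnj (G $ 0) * G $ 0) * H $ 1 - cnj (G $ 0) * H $ 0 * G $ 1"
    using arg_cong[OF *, of "\<lambda>F. F $ 2"] by (simp add: fps_mult_nth_small algebra_simps)
qed

text \<open>Dividing by z shifts the coefficients, so \<open>W $ 1\<close>, \<open>W $ 2\<close>,
  \<open>W $ 3\<close> are the first three coefficients of \<open>g\<close>. Then \<open>x\<close>
  and \<open>y\<close> are the values at 0 of the first and second Schur transforms of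
  \<open>g\<close>.\<close>

lemma Schwarz_function_coeffs:
  assumes w: "\<omega> holomorphic_on unit_disc" "\<omega> 0 = 0" "\<omega> ` unit_disc \<subseteq> unit_disc"
    and W: "\<omega> has_fps_expansion W"
  obtains x y where "cmod (W $ 1) \<le> 1" "cmod x \<le> 1" "cmod y \<le> 1"
    "W $ 2 = of_real (1 - (cmod (W $ 1))\<^sup>2) * x"
    "W $ 3 = of_real (1 - (cmod (W $ 1))\<^sup>2) * (of_real (1 - (cmod x)\<^sup>2) * y - cnj (W $ 1) * x\<^sup>2)"
proof -
  have cmod_compl: "of_real (1 - (cmod z)\<^sup>2) = 1 - cnj z * z" for z
    by (simp only: of_real_diff of_real_1 complex_norm_square mult.commute)
  obtain g where g: "g holomorphic_on unit_disc" "\<And>z. z \<in> unit_disc \<Longrightarrow> \<omega> z = z * g z"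
      "\<And>z. z \<in> unit_disc \<Longrightarrow> cmod (g z) \<le> 1"
    using Schwarz_quotient[OF w(1,2)] w(3) by (auto simp: image_subset_iff)
  obtain h where h: "h holomorphic_on unit_disc" "\<And>z. z \<in> unit_disc \<Longrightarrow> cmod (h z) \<le> 1"
      "\<forall>z\<in>unit_disc. g z * (1 + cnj (g 0) * (z * h z)) = g 0 + z * h z"
    using Schur_step[OF g(1,3)] by blast
  obtain k where k: "k holomorphic_on unit_disc" "\<And>z. z \<in> unit_disc \<Longrightarrow> cmod (k z) \<le> 1"
      "\<forall>z\<in>unit_disc. h z * (1 + cnj (h 0) * (z * k z)) = h 0 + z * k z"
    using Schur_step[OF h(1,2)] by blast
  define G H K where "G = fps_expansion g 0" "H = fps_expansion h 0" "K = fps_expansion k 0"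
  have e: "g has_fps_expansion G" "h has_fps_expansion H" "k has_fps_expansion K"
    unfolding G_H_K_def by (intro has_fps_expansion_unit_disc g h k)+
  have z: "g 0 = G $ 0" "h 0 = H $ 0" "k 0 = K $ 0"
    using e by (simp_all add: has_fps_expansion_imp_0_eq_fps_nth_0)
  have "W = fps_X * G"
    by (rule has_fps_expansion_eq_on_ball[OF W _ zero_less_one g(2)]) (intro has_fps_expansion_arith e)
  then have WG: "W $ 1 = G $ 0" "W $ 2 = G $ 1" "W $ 3 = G $ 2"
    by simp_all
  note G = Schur_step_coeffs[OF e(1,2) h(3)] and H = Schur_step_coeffs(1)[OF e(2,3) k(3)]
  show thesis
  proof (rule that[of "H $ 0" "K $ 0"])
    show "cmod (W $ 1) \<le> 1" "cmod (H $ 0) \<le> 1" "cmod (K $ 0) \<le> 1"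
      using g(3)[of 0] h(2)[of 0] k(2)[of 0] z WG by simp_all
    show "W $ 2 = of_real (1 - (cmod (W $ 1))\<^sup>2) * H $ 0"
      unfolding WG cmod_compl by (rule G(1))
    show "W $ 3 = of_real (1 - (cmod (W $ 1))\<^sup>2) *
        (of_real (1 - (cmod (H $ 0))\<^sup>2) * K $ 0 - cnj (W $ 1) * (H $ 0)\<^sup>2)"
      unfolding WG cmod_compl G(2) H G(1) by (simp add: algebra_simps power2_eq_square)
  qed
qed

section \<open>The estimate of c3 + 3/2 c1 c2 + \<nu> c1^3\<close>

text \<open>This is what remains of the case \<nu> = 0 once moduli are taken: \<open>c\<close> and
  \<open>r\<close> are the moduli of c1 and x, and y is bounded by 1.\<close>

lemma radial_bound:
  fixes c r :: real
  assumes "0 \<le> c" "c \<le> 1" "0 \<le> r" "r \<le> 1"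
  shows "(1 - c\<^sup>2) * (c * r\<^sup>2 + 1 - r\<^sup>2 + 3 / 2 * (c * r)) \<le> 1"
proof -
  have "0 \<le> (1 - c\<^sup>2) * ((1 - c) * r\<^sup>2 - 3 / 2 * (c * r)) + c\<^sup>2"
  \<comment> \<open>Completing the square in \<open>r\<close> leaves the remainder c^2 (7 - 9 c) /
    16, which is nonnegative exactly up to 7/9. Beyond that the quadratic in \<open>r\<close> is
    smallest on [0,1] at the end point r = 1.\<close>
  proof (cases "c \<le> 7 / 9")
    case True
    have "(1 - c\<^sup>2) * ((1 - c) * r\<^sup>2 - 3 / 2 * (c * r)) + c\<^sup>2
        = (1 + c) * ((1 - c) * r - 3 / 4 * c)\<^sup>2 + c\<^sup>2 * (7 - 9 * c) / 16"
      by algebra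
    then show ?thesis using True assms by simp
  next
    case False
    \<comment> \<open>The product is the excess of the quadratic over its value 1 - 5/2 c at r = 1.
      Its second factor is positive because (1 - c) (1 + r) is at most 4/9.\<close>
    have "0 \<le> (1 - r) * (3 / 2 * c - (1 - c) * (1 + r))"
      using mult_mono[of "1 - c" "2/9" "1 + r" 2] False assms by (intro mult_nonneg_nonneg) auto
    also have "\<dots> = (1 - c) * r\<^sup>2 - 3 / 2 * (c * r) - (1 - 5 / 2 * c)"
      by algebra
    finally have "1 - 5 / 2 * c \<le> (1 - c) * r\<^sup>2 - 3 / 2 * (c * r)"
      by simp
    then have "(1 - c\<^sup>2) * (1 - 5 / 2 * c) \<le> (1 - c\<^sup>2) * ((1 - c) * r\<^sup>2 - 3 / 2 * (c * r))"
      using assms by (intro mult_left_mono) (auto simp: power_le_one)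
    \<comment> \<open>The left side is the cubic 1 - 5/2 c + 5/2 c^3. It is compared with its
      tangent c/5 - 2/25 at 3/5, a rational point near its minimum at 1/sqrt 3; the tangent is
      positive for c > 2/5.\<close>
    moreover have "(1 - c\<^sup>2) * (1 - 5 / 2 * c) + c\<^sup>2
        = 5 / 2 * ((c - 3 / 5)\<^sup>2 * (c + 6 / 5)) + (c / 5 - 2 / 25)"
      by (simp add: field_simps power2_eq_square)
    moreover have "0 \<le> (c - 3 / 5)\<^sup>2 * (c + 6 / 5)"
      using assms by simp
    ultimately show ?thesis using False by linarith
  qed
  then show ?thesis by (simp add: algebra_simps)
qed

text \<open>The triangle inequality suffices for \<nu> = 0: only the moduli of \<open>c\<close> and
  \<open>x\<close> survive, and \<open>radial_bound\<close> applies.\<close>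

lemma third_order_bound_0:
  fixes c x y :: complex
  assumes "cmod c \<le> 1" "cmod x \<le> 1" "cmod y \<le> 1"
  shows "cmod (of_real (1 - (cmod c)\<^sup>2) * (of_real (1 - (cmod x)\<^sup>2) * y - cnj c * x\<^sup>2 + 3 / 2 * (c * x))) \<le> 1"
proof -
  define q where "q = of_real (1 - (cmod x)\<^sup>2) * y - cnj c * x\<^sup>2 + 3 / 2 * (c * x)"
  have d: "0 \<le> 1 - (cmod c)\<^sup>2" "0 \<le> 1 - (cmod x)\<^sup>2"
    using assms by (simp_all add: power_le_one)
  have "cmod q \<le> cmod (of_real (1 - (cmod x)\<^sup>2) * y) + cmod (cnj c * x\<^sup>2) + cmod (3 / 2 * (c * x))"
    unfolding q_def by (meson add_right_mono norm_triangle_ineq norm_triangle_ineq4 order_trans)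
  also have "\<dots> = (1 - (cmod x)\<^sup>2) * cmod y + cmod c * (cmod x)\<^sup>2 + 3 / 2 * (cmod c * cmod x)"
    using d by (simp add: norm_mult norm_power del: of_real_diff)
  also have "\<dots> \<le> cmod c * (cmod x)\<^sup>2 + 1 - (cmod x)\<^sup>2 + 3 / 2 * (cmod c * cmod x)"
    using mult_left_mono[OF assms(3) d(2)] by simp
  finally have "(1 - (cmod c)\<^sup>2) * cmod q
      \<le> (1 - (cmod c)\<^sup>2) * (cmod c * (cmod x)\<^sup>2 + 1 - (cmod x)\<^sup>2 + 3 / 2 * (cmod c * cmod x))"
    using d(1) by (rule mult_left_mono)
  also have "\<dots> \<le> 1"
    using assms by (intro radial_bound) auto
  finally show ?thesis
    using d by (simp add: norm_mult q_def del: of_real_diff)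
qed

text \<open>The part without y for \<nu> = 1. Adding moduli term by term is too lossy here (c = 3/5
  and |x| = 1 would give 1.176), so the squared modulus is computed exactly. The right side leaves
  just enough room for the y term.\<close>

lemma third_order_bound_1_real:
  fixes c :: real and x :: complex
  assumes "0 \<le> c" "c \<le> 1"
  shows "cmod (of_real (1 - c\<^sup>2) * (3 / 2 * (of_real c * x) - of_real c * x\<^sup>2) + (of_real c)^3)
      \<le> c\<^sup>2 + (1 - c\<^sup>2) * (cmod x)\<^sup>2"
proof (rule power2_le_imp_le)
  define p q d where "p = Re x" and "q = Im x" and "d = 1 - c\<^sup>2"
  define R where "R = p\<^sup>2 + q\<^sup>2"
  have d: "0 \<le> d" using assms by (simp add: d_def power_le_one)
  have x: "x = Complex p q" by (simp add: p_def q_def)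
  have R: "(cmod x)\<^sup>2 = R" by (simp add: cmod_power2 p_def q_def R_def)
  have "of_real d * (3 / 2 * (of_real c * x) - of_real c * x\<^sup>2) + (of_real c)^3
      = Complex (d * (3 / 2 * (c * p) - c * (p\<^sup>2 - q\<^sup>2)) + c^3) (d * (3 / 2 * (c * q) - c * (2 * p * q)))"
    by (simp add: x complex_eq_iff power2_eq_square power3_eq_cube)
  then have "(cmod (of_real d * (3 / 2 * (of_real c * x) - of_real c * x\<^sup>2) + (of_real c)^3))\<^sup>2
      = (d * (3 / 2 * (c * p) - c * (p\<^sup>2 - q\<^sup>2)) + c^3)\<^sup>2 + (d * (3 / 2 * (c * q) - c * (2 * p * q)))\<^sup>2"
    by (simp add: cmod_power2)
  txt \<open>For fixed \<open>R\<close> the defect is quadratic in \<open>p\<close>; completing that square leaves a positive form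
    in \<open>d * R - c\<^sup>2\<close> and \<open>d * c\<^sup>2 * R\<close>.\<close>
  also have "\<dots> = (c\<^sup>2 + d * R)\<^sup>2
      - d * (7 / 16 * (d * R - c\<^sup>2)\<^sup>2 + 7 / 4 * (d * (c\<^sup>2 * R)) + (2 * (c\<^sup>2 * p) + 3 / 4 * (d * R - c\<^sup>2))\<^sup>2)"
    unfolding d_def R_def by algebra
  also have "\<dots> \<le> (c\<^sup>2 + d * R)\<^sup>2"
    using d by (auto simp: R_def intro!: mult_nonneg_nonneg add_nonneg_nonneg)
  finally show "(cmod (of_real (1 - c\<^sup>2) * (3 / 2 * (of_real c * x) - of_real c * x\<^sup>2) + (of_real c)^3))\<^sup>2
      \<le> (c\<^sup>2 + (1 - c\<^sup>2) * (cmod x)\<^sup>2)\<^sup>2"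
    by (simp add: R d_def)
  show "0 \<le> c\<^sup>2 + (1 - c\<^sup>2) * (cmod x)\<^sup>2"
    using d by (simp add: d_def)
qed

text \<open>A rotation reduces the part without y to real nonnegative \<open>c\<close>. The y term
  adds at most d (1 - |x|^2), and |c|^2 + d |x|^2 + d (1 - |x|^2) = 1.\<close>

lemma third_order_bound_1:
  fixes c x y :: complex
  assumes "cmod c \<le> 1" "cmod x \<le> 1" "cmod y \<le> 1"
  shows "cmod (of_real (1 - (cmod c)\<^sup>2) * (of_real (1 - (cmod x)\<^sup>2) * y - cnj c * x\<^sup>2 + 3 / 2 * (c * x)) + c^3) \<le> 1"
proof -
  define d where "d = 1 - (cmod c)\<^sup>2"
  obtain u where u: "cmod u = 1" "c = of_real (cmod c) * u"
    by (metis cis_rcis_eq complex_cnj_one norm_cis rcis_cmod_Arg rcis_def)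
  have uu: "cnj u * u = 1" "u * cnj u = 1"
    using u(1) by (simp_all add: complex_norm_square[symmetric] mult.commute[of "cnj u"])
  \<comment> \<open>Giving \<open>c\<close> weight 1 and \<open>x\<close> weight 2 in
    \<open>u\<close> makes c x, \<open>cnj c\<close> x^2 and c^3 all of weight 3, so a common factor
    u^3 splits off.\<close>
  define v where "v = x * (cnj u)\<^sup>2"
  have xv: "x = v * u\<^sup>2"
    using uu by (simp add: v_def power2_eq_square algebra_simps)
  have cv: "cmod v = cmod x"
    using u(1) by (simp add: v_def norm_mult norm_power)
  have "of_real d * (3 / 2 * (c * x) - cnj c * x\<^sup>2) + c^3
      = u^3 * (of_real d * (3 / 2 * (of_real (cmod c) * v) - of_real (cmod c) * v\<^sup>2) + (of_real (cmod c))^3)"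
  proof -
    have 1: "cnj c = of_real (cmod c) * cnj u"
      using arg_cong[OF u(2), of cnj] by simp
    have "of_real d * (3 / 2 * (C * u * (v * u\<^sup>2)) - C * cnj u * (v * u\<^sup>2)\<^sup>2) + (C * u)^3
      = u^3 * (of_real d * (3 / 2 * (C * v) - C * v\<^sup>2) + C^3)" for C
      using uu(1) by algebra
    then show ?thesis
      unfolding xv 1 using u(2) by metis
  qed
  then have "cmod (of_real d * (3 / 2 * (c * x) - cnj c * x\<^sup>2) + c^3) \<le> (cmod c)\<^sup>2 + d * (cmod x)\<^sup>2"
    using third_order_bound_1_real[of "cmod c" v] assms(1)
    by (simp add: norm_mult norm_power u(1) cv d_def)
  moreover have "cmod (of_real d * (of_real (1 - (cmod x)\<^sup>2) * y)) \<le> d * (1 - (cmod x)\<^sup>2)"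
  proof -
    have d: "0 \<le> d" "0 \<le> 1 - (cmod x)\<^sup>2"
      using assms by (simp_all add: power_le_one d_def)
    then have "cmod (of_real d * (of_real (1 - (cmod x)\<^sup>2) * y)) = d * ((1 - (cmod x)\<^sup>2) * cmod y)"
      by (simp add: norm_mult del: of_real_diff)
    also have "\<dots> \<le> d * ((1 - (cmod x)\<^sup>2) * 1)"
      using d assms(3) by (intro mult_left_mono) auto
    finally show ?thesis by simp
  qed
  ultimately have "cmod ((of_real d * (3 / 2 * (c * x) - cnj c * x\<^sup>2) + c^3)
      + of_real d * (of_real (1 - (cmod x)\<^sup>2) * y)) \<le> (cmod c)\<^sup>2 + d * (cmod x)\<^sup>2 + d * (1 - (cmod x)\<^sup>2)"
    by (rule norm_triangle_le[OF add_mono])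
  also have "\<dots> = 1" by (simp add: d_def algebra_simps)
  finally show ?thesis
    by (simp add: d_def algebra_simps)
qed

text \<open>For \<nu> = \<alpha> + 1/2 the quantity estimated is 3 a4.\<close>

lemma Schwarz_function_third_order_bound:
  fixes \<nu> :: real
  assumes w: "\<omega> holomorphic_on unit_disc" "\<omega> 0 = 0" "\<omega> ` unit_disc \<subseteq> unit_disc"
    and W: "\<omega> has_fps_expansion W" and nu: "0 \<le> \<nu>"
  shows "cmod (W $ 3 + 3 / 2 * (W $ 1 * W $ 2) + of_real \<nu> * (W $ 1)^3) \<le> max 1 \<nu>"
proof -
  obtain x y where xy: "cmod (W $ 1) \<le> 1" "cmod x \<le> 1" "cmod y \<le> 1"
    "W $ 2 = of_real (1 - (cmod (W $ 1))\<^sup>2) * x"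
    "W $ 3 = of_real (1 - (cmod (W $ 1))\<^sup>2) * (of_real (1 - (cmod x)\<^sup>2) * y - cnj (W $ 1) * x\<^sup>2)"
    using Schwarz_function_coeffs[OF w W] by blast
  define P where "P = W $ 3 + 3 / 2 * (W $ 1 * W $ 2)"
  have P: "P = of_real (1 - (cmod (W $ 1))\<^sup>2) *
      (of_real (1 - (cmod x)\<^sup>2) * y - cnj (W $ 1) * x\<^sup>2 + 3 / 2 * (W $ 1 * x))"
    unfolding P_def xy(4,5) by (simp add: field_simps)
  have P0: "cmod P \<le> 1" and P1: "cmod (P + (W $ 1)^3) \<le> 1"
    unfolding P using third_order_bound_0[OF xy(1-3)] third_order_bound_1[OF xy(1-3)] by auto
  have "cmod (P + of_real \<nu> * (W $ 1)^3) \<le> max 1 \<nu>"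
  proof (cases "\<nu> \<le> 1")
    case True
    have "P + of_real \<nu> * (W $ 1)^3 = of_real (1 - \<nu>) * P + of_real \<nu> * (P + (W $ 1)^3)"
      by (simp add: algebra_simps)
    also have "cmod \<dots> \<le> (1 - \<nu>) * 1 + \<nu> * 1"
      using True nu P0 P1 by (intro norm_triangle_le[OF add_mono])
        (simp_all only: norm_mult norm_of_real, auto intro!: mult_left_le)
    finally show ?thesis by simp
  next
    case False
    have "P + of_real \<nu> * (W $ 1)^3 = (P + (W $ 1)^3) + of_real (\<nu> - 1) * (W $ 1)^3"
      by (simp add: algebra_simps)
    also have "cmod \<dots> \<le> 1 + (\<nu> - 1) * 1"
      using False P1 xy(1) by (intro norm_triangle_le[OF add_mono])
        (simp_all only: norm_mult norm_of_real norm_power, auto intro!: mult_left_le power_le_one)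
    finally show ?thesis by simp
  qed
  then show ?thesis by (simp add: P_def)
qed

section \<open>Passing between the class and Schwarz functions\<close>

text \<open>Coefficients of the subordination with denominators cleared are compared. The
  coefficient of z^n in z f' - f is (n - 1) a_n, whence the factors 2 and 3.\<close>

lemma coeffs_of_Schwarz_function:
  assumes f: "taylor_coeffs f a" and W: "\<omega> has_fps_expansion W" and W0: "\<omega> 0 = 0"
    and eq: "\<forall>z\<in>unit_disc.
      z * deriv f z * (1 - of_real \<alpha> * (\<omega> z * \<omega> z)) = f z * (1 - of_real \<alpha> * (\<omega> z * \<omega> z) + \<omega> z)"
  shows "a 2 = W $ 1" and "2 * a 3 = W $ 2 + (W $ 1)\<^sup>2"
    and "3 * a 4 = W $ 3 + 3 / 2 * (W $ 1 * W $ 2) + of_real (\<alpha> + 1 / 2) * (W $ 1)^3"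
proof -
  \<comment> \<open>\<open>taylor_coeffs\<close> fixes \<open>a\<close> from index 2 on; the
    coefficients 0 and 1 of \<open>f\<close> are put in by hand.\<close>
  define A where "A = Abs_fps (\<lambda>n. if n = 0 then 0 else if n = 1 then 1 else a n)"
  have A [simp]: "A $ 0 = 0" "A $ 1 = 1" "A $ Suc 0 = 1" "A $ Suc (Suc 0) = a 2"
    "A $ Suc (Suc (Suc 0)) = a 3" "A $ 2 = a 2" "A $ 3 = a 3" "A $ 4 = a 4"
    by (simp_all add: A_def eval_nat_numeral)
  have "f has_fps_expansion A"
  proof (rule has_fps_expansionI)
    have "eventually (\<lambda>z::complex. z \<in> unit_disc) (nhds 0)"
      by (intro eventually_nhds_in_open) auto
    then show "eventually (\<lambda>z. (\<lambda>n. A $ n * z ^ n) sums f z) (nhds 0)"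
    proof eventually_elim
      case (elim z)
      then have "(\<lambda>n. A $ (n + 2) * z ^ (n + 2)) sums (f z - z)"
        using f by (simp add: taylor_coeffs_def A_def)
      then show ?case
        by (subst (asm) sums_iff_shift) (simp add: eval_nat_numeral)
    qed
  qed
  then have "(\<lambda>z. z * deriv f z * (1 - of_real \<alpha> * (\<omega> z * \<omega> z))) has_fps_expansion
      fps_X * fps_deriv A * (1 - fps_const (of_real \<alpha>) * (W * W))"
    and "(\<lambda>z. f z * (1 - of_real \<alpha> * (\<omega> z * \<omega> z) + \<omega> z)) has_fps_expansion
      A * (1 - fps_const (of_real \<alpha>) * (W * W) + W)"
    by (intro has_fps_expansion_arith W; assumption)+
  then have *: "fps_X * fps_deriv A * (1 - fps_const (of_real \<alpha>) * (W * W))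
      = A * (1 - fps_const (of_real \<alpha>) * (W * W) + W)"
    by (rule has_fps_expansion_eq_on_ball[OF _ _ zero_less_one bspec[OF eq]])
  have [simp]: "W $ 0 = 0"
    using has_fps_expansion_imp_0_eq_fps_nth_0[OF W] W0 by simp
  have 2: "a 2 = W $ 1"
    using arg_cong[OF *, of "\<lambda>F. F $ 2"]
    by (simp add: fps_mult_nth_small mult.assoc[of fps_X])
  have 3: "2 * a 3 = W $ 2 + (W $ 1)\<^sup>2"
    using arg_cong[OF *, of "\<lambda>F. F $ 3"] 2
    by (simp add: fps_mult_nth_small mult.assoc[of fps_X] power2_eq_square algebra_simps)
  \<comment> \<open>The terms 2 \<alpha> c1 c2 coming from \<open>W * W\<close> cancel between the
    two sides.\<close>
  have 4: "3 * a 4 = W $ 3 + a 2 * W $ 2 + a 3 * W $ 1 + of_real \<alpha> * a 2 * (W $ 1)\<^sup>2"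
    using arg_cong[OF *, of "\<lambda>F. F $ 4"]
    by (simp add: fps_mult_nth_small mult.assoc[of fps_X] power2_eq_square algebra_simps)
  have h3: "a 3 = (W $ 2 + (W $ 1)\<^sup>2) / 2" using 3 by (simp add: eq_divide_eq mult.commute)
  show "a 2 = W $ 1" "2 * a 3 = W $ 2 + (W $ 1)\<^sup>2" by (fact 2, fact 3)
  show "3 * a 4 = W $ 3 + 3 / 2 * (W $ 1 * W $ 2) + of_real (\<alpha> + 1 / 2) * (W $ 1)^3"
    unfolding 4 2 h3 by (simp add: field_simps power2_eq_square power3_eq_cube)
qed

lemma booth_denominator_nonzero:
  assumes "0 \<le> \<alpha>" "\<alpha> \<le> 1" "cmod w < 1"
  shows "1 - of_real \<alpha> * w\<^sup>2 \<noteq> 0"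
proof
  assume "1 - of_real \<alpha> * w\<^sup>2 = 0"
  then have "cmod (of_real \<alpha> * w\<^sup>2) = 1" by simp
  then have "\<alpha> * (cmod w)\<^sup>2 = 1" using assms by (simp add: norm_mult norm_power)
  moreover have "(cmod w)\<^sup>2 < 1" using assms(3) by (simp add: power_less_one_iff)
  moreover have "\<alpha> * (cmod w)\<^sup>2 \<le> (cmod w)\<^sup>2" using assms by (simp add: mult_left_le_one_le)
  ultimately show False by linarith
qed

text \<open>Off the origin \<open>f z\<close> and the denominator of \<open>booth_F\<close> are
  nonzero and can be multiplied out; at the origin both sides vanish.\<close>

lemma BS_Schwarz_function:
  assumes \<alpha>: "0 \<le> \<alpha>" "\<alpha> \<le> 1" and f: "f \<in> class_BS \<alpha>"
  obtains \<omega> where "\<omega> holomorphic_on unit_disc" "\<omega> 0 = 0" "\<omega> ` unit_disc \<subseteq> unit_disc"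
    "\<forall>z\<in>unit_disc.
      z * deriv f z * (1 - of_real \<alpha> * (\<omega> z * \<omega> z)) = f z * (1 - of_real \<alpha> * (\<omega> z * \<omega> z) + \<omega> z)"
proof -
  obtain \<omega> where w: "\<omega> holomorphic_on unit_disc" "\<omega> 0 = 0" "\<omega> ` unit_disc \<subseteq> unit_disc"
      "\<And>z. z \<in> unit_disc \<Longrightarrow> star_quotient f z - 1 = booth_F \<alpha> (\<omega> z)"
    using f unfolding class_BS_def subordinate_def by blast
  have f0: "f 0 = 0" "\<And>z. z \<in> unit_disc - {0} \<Longrightarrow> f z \<noteq> 0"
    using f by (auto simp: class_BS_def class_A_def)
  have "z * deriv f z * (1 - of_real \<alpha> * (\<omega> z * \<omega> z)) = f z * (1 - of_real \<alpha> * (\<omega> z * \<omega> z) + \<omega> z)"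
    if z: "z \<in> unit_disc" for z
  proof (cases "z = 0")
    case False
    have "1 - of_real \<alpha> * (\<omega> z)\<^sup>2 \<noteq> 0"
      using w(3) z by (intro booth_denominator_nonzero \<alpha>) (auto simp: image_subset_iff)
    moreover have "z * deriv f z / f z - 1 = \<omega> z / (1 - of_real \<alpha> * (\<omega> z)\<^sup>2)"
      using w(4)[OF z] False by (simp add: star_quotient_def booth_F_def)
    moreover have "f z \<noteq> 0" using f0 z False by simp
    ultimately show ?thesis
      by (simp add: field_simps power2_eq_square)
  qed (simp add: f0)
  with that w(1-3) show thesis by blast
qed

text \<open>The converse: with the Schwarz function z \<phi>(z), the differential equation for
  \<open>f\<close> is solved by z times the exponential of a primitive of
  \<open>\<psi>\<close>.\<close>

lemma BS_from_Schwarz_function: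
  assumes \<alpha>: "0 \<le> \<alpha>" "\<alpha> \<le> 1" and p: "\<phi> holomorphic_on unit_disc"
    and bd: "\<And>z. z \<in> unit_disc \<Longrightarrow> cmod (z * \<phi> z) < 1"
  obtains f a where "f \<in> class_BS \<alpha>" "taylor_coeffs f a"
    "\<forall>z\<in>unit_disc.
      z * deriv f z * (1 - of_real \<alpha> * (z * \<phi> z * (z * \<phi> z)))
        = f z * (1 - of_real \<alpha> * (z * \<phi> z * (z * \<phi> z)) + z * \<phi> z)"
proof -
  \<comment> \<open>This is \<open>booth_F\<close> at z \<phi>(z) divided by z, with the singularity
    at 0 removed; it has to be f'/f - 1/z.\<close>
  define \<psi> where "\<psi> = (\<lambda>z. \<phi> z / (1 - of_real \<alpha> * (z * \<phi> z)\<^sup>2))"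
  have nz: "1 - of_real \<alpha> * (z * \<phi> z)\<^sup>2 \<noteq> 0" if "z \<in> unit_disc" for z
    using bd[OF that] by (intro booth_denominator_nonzero \<alpha>)
  have psi: "\<psi> holomorphic_on unit_disc"
    unfolding \<psi>_def using nz by (intro holomorphic_intros p) auto
  obtain g0 where g0: "\<And>z. z \<in> unit_disc \<Longrightarrow> (g0 has_field_derivative \<psi> z) (at z within unit_disc)"
    by (rule holomorphic_convex_primitive'[OF convex_ball open_ball psi]) blast
  \<comment> \<open>The primitive vanishing at 0 makes \<open>deriv f 0 = 1\<close>.\<close>
  define g where "g = (\<lambda>z. g0 z - g0 0)"
  have g: "(g has_field_derivative \<psi> z) (at z)" if "z \<in> unit_disc" for z
    using g0[OF that] that unfolding g_def at_within_open[OF that open_ball]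
    by (auto intro!: derivative_eq_intros)
  define f where "f = (\<lambda>z. z * exp (g z))"
  have f': "(f has_field_derivative exp (g z) * (1 + z * \<psi> z)) (at z)" if "z \<in> unit_disc" for z
    unfolding f_def by (auto intro!: derivative_eq_intros g that simp: algebra_simps)
  have df: "deriv f z = exp (g z) * (1 + z * \<psi> z)" if "z \<in> unit_disc" for z
    using f'[OF that] by (rule DERIV_imp_deriv)
  have hol: "f holomorphic_on unit_disc"
    unfolding holomorphic_on_open[OF open_ball] using f' by blast
  have sq: "star_quotient f z - 1 = z * \<psi> z" if "z \<in> unit_disc" for z
    using that by (simp add: star_quotient_def df, simp add: f_def)
  have "booth_F \<alpha> holomorphic_on unit_disc"
    unfolding booth_F_def using booth_denominator_nonzero[OF \<alpha>] by (intro holomorphic_intros) auto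
  moreover have "(\<lambda>z. star_quotient f z - 1) holomorphic_on unit_disc"
    using holomorphic_on_mult[OF holomorphic_on_ident psi]
    by (rule holomorphic_transform) (simp add: sq)
  moreover have "(\<lambda>z. z * \<phi> z) holomorphic_on unit_disc"
    by (intro holomorphic_intros p)
  ultimately have "subordinate (\<lambda>z. star_quotient f z - 1) (booth_F \<alpha>)"
    unfolding subordinate_def using bd sq
    by (intro conjI exI[of _ "\<lambda>z. z * \<phi> z"]) (auto simp: booth_F_def \<psi>_def)
  then have BS: "f \<in> class_BS \<alpha>"
    using hol by (auto simp: class_BS_def class_A_def df, auto simp: f_def g_def)
  define A where "A = fps_expansion f 0"
  have A: "f has_fps_expansion A"
    unfolding A_def by (rule has_fps_expansion_unit_disc[OF hol])
  have A0: "A $ 0 = 0" "A $ Suc 0 = 1"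
    using df[of 0] by (simp_all add: fps_nth_fps_expansion[OF A] f_def g_def)
  have "taylor_coeffs f (fps_nth A)"
    unfolding taylor_coeffs_def
  proof
    fix z :: complex assume "z \<in> unit_disc"
    then have "(\<lambda>n. A $ n * z ^ n) sums f z"
      using has_fps_expansion_imp_sums_complex[OF A, of 1 z] hol by (simp add: one_ereal_def)
    then show "(\<lambda>n. A $ (n + 2) * z ^ (n + 2)) sums (f z - z)"
      by (subst sums_iff_shift) (simp add: eval_nat_numeral A0)
  qed
  moreover have "z * deriv f z * (1 - of_real \<alpha> * (z * \<phi> z * (z * \<phi> z)))
        = f z * (1 - of_real \<alpha> * (z * \<phi> z * (z * \<phi> z)) + z * \<phi> z)" if "z \<in> unit_disc" for z
  proof -
    have "(1 + z * \<psi> z) * (1 - of_real \<alpha> * (z * \<phi> z)\<^sup>2) = 1 - of_real \<alpha> * (z * \<phi> z)\<^sup>2 + z * \<phi> z"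
      using nz[OF that] by (simp add: \<psi>_def field_simps)
    then show ?thesis
      unfolding df[OF that] unfolding f_def power2_eq_square by algebra
  qed
  ultimately show thesis
    using that BS by blast
qed

section \<open>Extremal functions and the coefficient bounds\<close>

text \<open>The Schwarz function is z^(k+1). The choice k = 0 is extremal for a2, and for a4 when
  \<alpha> is at least 1/2; k = 1 is extremal for a3; k = 2 for a4 when \<alpha> is at most
  1/2.\<close>

lemma BS_extremal:
  assumes \<alpha>: "0 \<le> \<alpha>" "\<alpha> \<le> 1"
  shows "\<exists>f a. f \<in> class_BS \<alpha> \<and> taylor_coeffs f a \<and>
    a 2 = (if k = 0 then 1 else 0) \<and>
    2 * a 3 = (if k \<le> 1 then 1 else 0) \<and>
    3 * a 4 = (if k = 0 then of_real (\<alpha> + 1 / 2) else if k = (2::nat) then 1 else 0)"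
proof -
  have "cmod (z * z ^ k) < 1" if "z \<in> unit_disc" for z :: complex
    using that by (simp add: power_less_one_iff norm_power flip: power_Suc)
  then obtain f a where fa: "f \<in> class_BS \<alpha>" "taylor_coeffs f a"
    "\<forall>z\<in>unit_disc.
      z * deriv f z * (1 - of_real \<alpha> * (z * z ^ k * (z * z ^ k)))
        = f z * (1 - of_real \<alpha> * (z * z ^ k * (z * z ^ k)) + z * z ^ k)"
    using BS_from_Schwarz_function[OF \<alpha>, of "\<lambda>z. z ^ k"] holomorphic_on_power[OF holomorphic_on_ident]
    by blast
  have "(\<lambda>z::complex. z * z ^ k) has_fps_expansion fps_X ^ Suc k"
    unfolding power_Suc by (intro has_fps_expansion_arith has_fps_expansion_power)
  note * = coeffs_of_Schwarz_function[OF fa(2) this _ fa(3)]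
  have "a 2 = (if k = 0 then 1 else 0)"
    "2 * a 3 = (if k \<le> 1 then 1 else 0)"
    "3 * a 4 = (if k = 0 then of_real (\<alpha> + 1 / 2) else if k = 2 then 1 else 0)"
    using * by (auto simp: fps_X_power_nth)
  with fa(1,2) show ?thesis by blast
qed

lemma BS_coefficient_bounds:
  assumes \<alpha>: "0 \<le> \<alpha>" "\<alpha> \<le> 1" and f: "f \<in> class_BS \<alpha>" and a: "taylor_coeffs f a"
  shows "cmod (a 2) \<le> 1" "cmod (a 3) \<le> 1 / 2" "cmod (a 4) \<le> max 1 (\<alpha> + 1 / 2) / 3"
proof -
  obtain \<omega> where w: "\<omega> holomorphic_on unit_disc" "\<omega> 0 = 0" "\<omega> ` unit_disc \<subseteq> unit_disc"
    "\<forall>z\<in>unit_disc.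
      z * deriv f z * (1 - of_real \<alpha> * (\<omega> z * \<omega> z)) = f z * (1 - of_real \<alpha> * (\<omega> z * \<omega> z) + \<omega> z)"
    using BS_Schwarz_function[OF \<alpha> f] by blast
  define W where "W = fps_expansion \<omega> 0"
  have W: "\<omega> has_fps_expansion W"
    unfolding W_def by (rule has_fps_expansion_unit_disc[OF w(1)])
  obtain x where x: "cmod (W $ 1) \<le> 1" "cmod x \<le> 1" "W $ 2 = of_real (1 - (cmod (W $ 1))\<^sup>2) * x"
    using Schwarz_function_coeffs[OF w(1-3) W] by metis
  note A = coeffs_of_Schwarz_function[OF a W w(2,4)]
  show "cmod (a 2) \<le> 1"
    using A(1) x(1) by simp
  have d: "0 \<le> 1 - (cmod (W $ 1))\<^sup>2"
    using x(1) by (simp add: power_le_one)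
  then have "cmod (W $ 2) \<le> 1 - (cmod (W $ 1))\<^sup>2"
    unfolding x(3) norm_mult norm_of_real using x(2) by (simp add: mult_left_le)
  \<comment> \<open>The bound 1 - |c1|^2 on |c2| exactly offsets the summand c1^2.\<close>
  then have "cmod (2 * a 3) \<le> 1 - (cmod (W $ 1))\<^sup>2 + (cmod (W $ 1))\<^sup>2"
    unfolding A(2) by (rule norm_triangle_le[OF add_mono]) (simp add: norm_power)
  then show "cmod (a 3) \<le> 1 / 2"
    by (simp add: norm_mult)
  have "cmod (3 * a 4) \<le> max 1 (\<alpha> + 1 / 2)"
    unfolding A(3) using \<alpha> by (intro Schwarz_function_third_order_bound[OF w(1-3) W]) simp
  then show "cmod (a 4) \<le> max 1 (\<alpha> + 1 / 2) / 3"
    by (simp add: norm_mult)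
qed

theorem theorem2p1:
  fixes \<alpha> :: real
  assumes "0 \<le> \<alpha>" and "\<alpha> \<le> 1"
  shows "(\<forall>f a. f \<in> class_BS \<alpha> \<and> taylor_coeffs f a \<longrightarrow>
            cmod (a 2) \<le> 1 \<and> cmod (a 3) \<le> 1 / 2 \<and>
            cmod (a 4) \<le> (if \<alpha> \<le> 1 / 2 then 1 / 3 else (1 + 2 * \<alpha>) / 6)) \<and>
         (\<exists>f a. f \<in> class_BS \<alpha> \<and> taylor_coeffs f a \<and> cmod (a 2) = 1) \<and>
         (\<exists>f a. f \<in> class_BS \<alpha> \<and> taylor_coeffs f a \<and> cmod (a 3) = 1 / 2) \<and>
         (\<exists>f a. f \<in> class_BS \<alpha> \<and> taylor_coeffs f a \<and>
            cmod (a 4) = (if \<alpha> \<le> 1 / 2 then 1 / 3 else (1 + 2 * \<alpha>) / 6))"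
proof -
  have max_eq: "max 1 (\<alpha> + 1 / 2) / 3 = (if \<alpha> \<le> 1 / 2 then 1 / 3 else (1 + 2 * \<alpha>) / 6)"
    by auto
  obtain f0 a0 where 0: "f0 \<in> class_BS \<alpha>" "taylor_coeffs f0 a0" "a0 2 = 1"
      "3 * a0 4 = of_real (\<alpha> + 1 / 2)"
    using BS_extremal[OF assms, of 0] by (auto simp del: of_real_add)
  obtain f1 a1 where 1: "f1 \<in> class_BS \<alpha>" "taylor_coeffs f1 a1" "2 * a1 3 = 1"
    using BS_extremal[OF assms, of 1] by auto
  obtain f2 a2 where 2: "f2 \<in> class_BS \<alpha>" "taylor_coeffs f2 a2" "3 * a2 4 = 1"
    using BS_extremal[OF assms, of 2] by auto
  have n0: "cmod (a0 4) = (1 + 2 * \<alpha>) / 6"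
    using arg_cong[OF 0(4), of cmod] assms(1) by (simp add: norm_mult del: of_real_add)
  have n1: "cmod (a1 3) = 1 / 2"
    using arg_cong[OF 1(3), of cmod] by (simp add: norm_mult)
  have n2: "cmod (a2 4) = 1 / 3"
    using arg_cong[OF 2(3), of cmod] by (simp add: norm_mult)
  have "\<exists>f a. f \<in> class_BS \<alpha> \<and> taylor_coeffs f a \<and>
      cmod (a 4) = (if \<alpha> \<le> 1 / 2 then 1 / 3 else (1 + 2 * \<alpha>) / 6)"
    \<comment> \<open>The extremal function switches at 1/2, where the two bounds agree:
      \<open>f2\<close> serves up to 1/2 and \<open>f0\<close> beyond.\<close>
    using 0(1,2) 2(1,2) n0 n2 by (cases "\<alpha> \<le> 1 / 2") auto
  moreover have "\<exists>f a. f \<in> class_BS \<alpha> \<and> taylor_coeffs f a \<and> cmod (a 2) = 1"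
    using 0 by (intro exI[of _ f0] exI[of _ a0]) simp
  moreover have "\<exists>f a. f \<in> class_BS \<alpha> \<and> taylor_coeffs f a \<and> cmod (a 3) = 1 / 2"
    using 1 n1 by blast
  ultimately show ?thesis
    using BS_coefficient_bounds[OF assms] unfolding max_eq by blast
qed

end
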